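(* Let $\mathcal{D}\subseteq\mathbb{R}^n$ be open, let $f\colon\mathcal{D}\to\mathbb{R}^n$ be locally Lipschitz and $G\colon\mathcal{D}\to\mathbb{R}^{n\times m}$ be continuous. Let $h_1,\ldots,h_p\colon\mathcal{D}\to\mathbb{R}$ be continuously differentiable, define $h(x)\triangleq\min_{i\in\{1,\ldots,p\}}h_i(x)$, and let $\mathcal{C}\triangleq\{x\in\mathcal{D}:h(x)\ge0\}$. Let $\alpha\in\mathcal{K}_e$, and suppose the following assumption holds: for all $x\in\mathcal{D}$ and all $i\in\mathcal{A}(x)$ with $h_i(x)=0$, the row vector $L_Gh_i(x)\in\mathbb{R}^{1\times m}$ is nonzero, and there exists $u\in\mathbb{R}^m$ such that, for all $k\in\mathcal{A}(x)$, $L_fh_k(x)+L_Gh_k(x)\,u+\alpha(h_k(x))\ge0$. Let $\delta>0$, and let $u_*\colon\mathcal{D}\to\mathbb{R}^m$ be locally Lipschitz such that, for all $x\in\mathcal{D}$ and all $i\in\mathcal{A}_\delta(x)$, $$L_fh_i(x)+L_Gh_i(x)\,u_*(x)+\alpha(h_i(x))\ge0,$$ where the Lie derivatives are obtained from the dual-algebraic evaluation, $L_fh_i(x)=\mathfrak{D}\big(\tilde h_i(x_{\mathbb{D},f})\big)$ and $L_{\mathrm{col}_j(G)}h_i(x)=\mathfrak{D}\big(\tilde h_i(x_{\mathbb{D},\mathrm{col}_j(G)})\big)$ for $j\in\{1,\ldots,m\}$. Then $\mathcal{C}$ is forward invariant with respect to the closed-loop system $\dot x=f(x)+G(x)u_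*(x)$.
   Context: $\mathcal{K}_e$ (extended class-$\mathcal{K}$) is the set of continuous functions $\alpha\colon(-b,a)\to\mathbb{R}$, $a,b>0$, that are increasing with $\alpha(0)=0$; wherever $\alpha(s)$ is written, $s$ is understood to lie in the domain of $\alpha$. The active set is $\mathcal{A}(x)\triangleq\{i\in\{1,\ldots,p\}:h_i(x)=h(x)\}$, and for $\delta\ge0$ the $\delta$-active set is $\mathcal{A}_\delta(x)\triangleq\{i\in\{1,\ldots,p\}:h_i(x)\le h(x)+\delta\}$. Lie derivatives: $L_fh_i(x)\triangleq\nabla h_i(x)f(x)\in\mathbb{R}$, $L_Gh_i(x)\triangleq\nabla h_i(x)G(x)\in\mathbb{R}^{1\times m}$, with $\nabla h_i$ a row vector; $\mathrm{col}_j(G)$ is the $j$-th column of $G$. Dual numbers: $\mathbb{D}\triangleq\mathbb{R}[\epsilon]/(\epsilon^2)$, and $\mathfrak{D}(a+b\epsilon)\triangleq b$. For a vector field $v\colon\mathcal{D}\to\mathbb{R}^n$, $x_{\mathbb{D},v}\triangleq x+v(x)\epsilon\in\mathbb{D}^n$, and the dual extension of $h_i$ is $\tilde h_i(x+w\epsilon)\triangleq h_i(x)+\nabla h_i(x)\,w\,\epsilon$. Forward invariance of $\mathcal{C}$ means: every solution $x(\cdot)$ of the closed-loop system with $x(0)\in\mathcal{C}$ satisfies $x(t)\in\mathcal{C}$ for all $t\ge0$ in its interval of existence. *)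

theory Defs
  imports "HOL-Analysis.Analysis" "HOL-Computational_Algebra.Polynomial"
begin

definition locally_lipschitz_on :: "'a::metric_space set \<Rightarrow> ('a \<Rightarrow> 'b::metric_space) \<Rightarrow> bool" where
  "locally_lipschitz_on X f \<longleftrightarrow> local_lipschitz (UNIV :: real set) X (\<lambda>_. f)"

lemma locally_lipschitz_on_iff:
  "locally_lipschitz_on X f \<longleftrightarrow> (\<forall>x\<in>X. \<exists>r>0. \<exists>L. L-lipschitz_on (cball x r \<inter> X) f)"
proof
  assume "locally_lipschitz_on X f"
  then have lip: "\<forall>x\<in>X. \<forall>t::real. \<exists>u>0. \<exists>L. \<forall>t\<in>cball t u \<inter> UNIV. L-lipschitz_on (cball x u \<inter> X) f"
    by (auto simp: locally_lipschitz_on_def local_lipschitz_def)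
  show "\<forall>x\<in>X. \<exists>r>0. \<exists>L. L-lipschitz_on (cball x r \<inter> X) f"
  proof
    fix x assume "x \<in> X"
    then obtain u L where "u > 0"
      and "\<forall>t\<in>cball (0::real) u \<inter> UNIV. L-lipschitz_on (cball x u \<inter> X) f"
      using lip by meson
    moreover have "(0::real) \<in> cball 0 u \<inter> UNIV" using \<open>u > 0\<close> by simp
    ultimately show "\<exists>r>0. \<exists>L. L-lipschitz_on (cball x r \<inter> X) f" by blast
  qed
next
  assume "\<forall>x\<in>X. \<exists>r>0. \<exists>L. L-lipschitz_on (cball x r \<inter> X) f"
  then show "locally_lipschitz_on X f"
    unfolding locally_lipschitz_on_def local_lipschitz_def by blast
qed

definition grad :: "(real^'n \<Rightarrow> real) \<Rightarrow> real^'n \<Rightarrow> real^'n" where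
  "grad h x = (\<chi> j. frechet_derivative h (at x) (axis j 1))"

lemma frechet_derivative_eq_grad:
  assumes "h differentiable (at x)"
  shows "frechet_derivative h (at x) w = grad h x \<bullet> w"
proof -
  have lin: "linear (frechet_derivative h (at x))"
    using assms by (rule linear_frechet_derivative)
  have "frechet_derivative h (at x) w = frechet_derivative h (at x) (\<Sum>j\<in>UNIV. w $ j *\<^sub>R axis j 1)"
    by (simp add: basis_expansion flip: scalar_mult_eq_scaleR)
  also have "\<dots> = grad h x \<bullet> w"
    by (simp add: linear_sum[OF lin] linear_scale[OF lin] grad_def inner_vec_def mult.commute)
  finally show ?thesis .
qed

definition continuously_differentiable_on :: "(real^'n) set \<Rightarrow> (real^'n \<Rightarrow> real) \<Rightarrow> bool" where
  "continuously_differentiable_on D h \<longleftrightarrow>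
     (\<forall>x\<in>D. h differentiable (at x)) \<and> continuous_on D (grad h)"

definition lie_deriv :: "(real^'n \<Rightarrow> real^'n) \<Rightarrow> (real^'n \<Rightarrow> real) \<Rightarrow> real^'n \<Rightarrow> real" where
  "lie_deriv f h x = grad h x \<bullet> f x"

definition lie_deriv_row :: "(real^'n \<Rightarrow> real^'m^'n) \<Rightarrow> (real^'n \<Rightarrow> real) \<Rightarrow> real^'n \<Rightarrow> real^'m" where
  "lie_deriv_row G h x = grad h x v* G x"

definition min_fun :: "nat \<Rightarrow> (nat \<Rightarrow> 'a \<Rightarrow> real) \<Rightarrow> 'a \<Rightarrow> real" where
  "min_fun p hs x = Min ((\<lambda>i. hs i x) ` {1..p})"

definition active_set :: "nat \<Rightarrow> (nat \<Rightarrow> 'a \<Rightarrow> real) \<Rightarrow> 'a \<Rightarrow> nat set" where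
  "active_set p hs x = {i\<in>{1..p}. hs i x = min_fun p hs x}"

definition delta_active_set :: "real \<Rightarrow> nat \<Rightarrow> (nat \<Rightarrow> 'a \<Rightarrow> real) \<Rightarrow> 'a \<Rightarrow> nat set" where
  "delta_active_set \<delta> p hs x = {i\<in>{1..p}. hs i x \<le> min_fun p hs x + \<delta>}"

(* The domain of alpha is the open interval einterval (-b) a = {s. -b < s < a}; the endpoints are
   extended reals so that alpha may also be defined on a half-line or on the whole line.
   "Increasing" is read strictly, as is usual for class K. *)
definition ext_class_K :: "ereal \<Rightarrow> ereal \<Rightarrow> (real \<Rightarrow> real) \<Rightarrow> bool" where
  "ext_class_K a b \<alpha> \<longleftrightarrow> 0 < a \<and> 0 < b \<and>
     continuous_on (einterval (- b) a) \<alpha> \<and> strict_mono_on (einterval (- b) a) \<alpha> \<and> \<alpha> 0 = 0"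

(* Dual a b stands for a + b * eps. *)
datatype dual_number = Dual (real_part: real) (dual_part: real)

instantiation dual_number :: comm_ring_1
begin

definition zero_dual_number :: dual_number where "0 = Dual 0 0"
definition one_dual_number :: dual_number where "1 = Dual 1 0"
definition plus_dual_number :: "dual_number \<Rightarrow> dual_number \<Rightarrow> dual_number" where
  "z + w = Dual (real_part z + real_part w) (dual_part z + dual_part w)"
definition minus_dual_number :: "dual_number \<Rightarrow> dual_number \<Rightarrow> dual_number" where
  "z - w = Dual (real_part z - real_part w) (dual_part z - dual_part w)"
definition uminus_dual_number :: "dual_number \<Rightarrow> dual_number" where
  "- z = Dual (- real_part z) (- dual_part z)"
definition times_dual_number :: "dual_number \<Rightarrow> dual_number \<Rightarrow> dual_number" where
  "z * w = Dual (real_part z * real_part w) (real_part z * dual_part w + dual_part z * real_part w)"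

instance
  by standard
    (auto simp: zero_dual_number_def one_dual_number_def plus_dual_number_def
      minus_dual_number_def uminus_dual_number_def times_dual_number_def algebra_simps)

end

definition eps :: dual_number where "eps = Dual 0 1"

lemma eps_squared: "eps * eps = 0"
  by (simp add: eps_def times_dual_number_def zero_dual_number_def)

lemma Dual_eq: "Dual a b = Dual a 0 + Dual b 0 * eps"
  by (simp add: eps_def times_dual_number_def plus_dual_number_def)

(* The next lemmas identify dual_number with R[X]/(X^2): dual_of_poly is a surjective ring
   homomorphism with kernel (X^2) that sends X to eps. *)
definition dual_of_poly :: "real poly \<Rightarrow> dual_number" where
  "dual_of_poly q = Dual (coeff q 0) (coeff q 1)"

lemma dual_of_poly_hom:
  "dual_of_poly 1 = 1"
  "dual_of_poly (q + r) = dual_of_poly q + dual_of_poly r"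
  "dual_of_poly (q * r) = dual_of_poly q * dual_of_poly r"
  by (simp_all add: dual_of_poly_def one_dual_number_def plus_dual_number_def
      times_dual_number_def coeff_mult)

lemma dual_of_poly_X: "dual_of_poly [:0, 1:] = eps"
  by (simp add: dual_of_poly_def eps_def)

lemma surj_dual_of_poly: "surj dual_of_poly"
proof (rule surjI)
  show "dual_of_poly [:real_part z, dual_part z:] = z" for z
    by (simp add: dual_of_poly_def)
qed

lemma dual_of_poly_eq_0_iff: "dual_of_poly q = 0 \<longleftrightarrow> [:0, 1:]^2 dvd q"
proof -
  have "[:0, 1:]^2 = monom (1::real) 2" by (simp add: monom_altdef)
  moreover have "(\<forall>k<2. coeff q k = 0) \<longleftrightarrow> coeff q 0 = 0 \<and> coeff q 1 = 0"
    by (auto simp: numeral_2_eq_2 less_Suc_eq)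
  ultimately show ?thesis
    by (simp only: monom_1_dvd_iff') (simp add: dual_of_poly_def zero_dual_number_def)
qed

definition dual_point :: "(real^'n \<Rightarrow> real^'n) \<Rightarrow> real^'n \<Rightarrow> dual_number^'n" where
  "dual_point v x = (\<chi> i. Dual (x $ i) (v x $ i))"

definition dual_ext :: "(real^'n \<Rightarrow> real) \<Rightarrow> dual_number^'n \<Rightarrow> dual_number" where
  "dual_ext h z =
     (let x = (\<chi> i. real_part (z $ i)); w = (\<chi> i. dual_part (z $ i)) in Dual (h x) (grad h x \<bullet> w))"

definition dual_lie_deriv :: "(real^'n \<Rightarrow> real^'n) \<Rightarrow> (real^'n \<Rightarrow> real) \<Rightarrow> real^'n \<Rightarrow> real" where
  "dual_lie_deriv v h x = dual_part (dual_ext h (dual_point v x))"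

definition dual_lie_deriv_row ::
    "(real^'n \<Rightarrow> real^'m^'n) \<Rightarrow> (real^'n \<Rightarrow> real) \<Rightarrow> real^'n \<Rightarrow> real^'m" where
  "dual_lie_deriv_row G h x = (\<chi> j. dual_lie_deriv (\<lambda>y. column j (G y)) h x)"

(* Solutions are classical and live on an arbitrary interval J containing the initial time 0;
   at an endpoint belonging to J the derivative is one-sided. *)
definition is_solution :: "(real^'n) set \<Rightarrow> (real^'n \<Rightarrow> real^'n) \<Rightarrow> real set \<Rightarrow> (real \<Rightarrow> real^'n) \<Rightarrow> bool" where
  "is_solution D F J \<phi> \<longleftrightarrow> is_interval J \<and> 0 \<in> J \<and>
     (\<forall>t\<in>J. \<phi> t \<in> D \<and> (\<phi> has_vector_derivative F (\<phi> t)) (at t within J))"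

definition forward_invariant :: "(real^'n) set \<Rightarrow> (real^'n \<Rightarrow> real^'n) \<Rightarrow> (real^'n) set \<Rightarrow> bool" where
  "forward_invariant D F C \<longleftrightarrow>
     (\<forall>J \<phi>. is_solution D F J \<phi> \<and> \<phi> 0 \<in> C \<longrightarrow> (\<forall>t\<in>J. 0 \<le> t \<longrightarrow> \<phi> t \<in> C))"

end

theory Submission
  imports Defs
begin

text \<open>
  Along a closed-loop solution, let H be the minimum of the constraint functions. If H became negative,
  choose a level c < 0 in the domain of \<open>\<alpha>\<close> which H reaches, and the first time T with H(T) = c. An active
  constraint at T has derivative at least \<open>- \<alpha>(c) > 0\<close>, so H was below c shortly before T; by the
  intermediate value theorem it attained c even earlier, which is absurd. Uniqueness of solutions plays
  no role.
\<close>

lemma dual_lie_deriv_eq_inner: "dual_lie_deriv v h x = grad h x \<bullet> v x"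
  by (simp add: dual_lie_deriv_def dual_ext_def dual_point_def Let_def)

text \<open>\<open>G x *v u\<close> is the combination of the columns of \<open>G x\<close> with
  coefficients \<open>u $ j\<close>, and the inner product is linear. This turns the dual-number
  constraint into a statement about the derivative along the input direction.\<close>

lemma dual_lie_deriv_row_inner: "dual_lie_deriv_row G h x \<bullet> u = grad h x \<bullet> (G x *v u)"
proof -
  have "grad h x \<bullet> (G x *v u) = (\<Sum>j\<in>UNIV. u $ j * (grad h x \<bullet> column j (G x)))"
    by (simp add: matrix_mult_sum inner_sum_right scalar_mult_eq_scaleR)
  then show ?thesis
    by (simp add: dual_lie_deriv_row_def dual_lie_deriv_eq_inner inner_vec_def[of "vec_lambda _"]
        mult.commute)
qed

text \<open>Induction on \<open>p\<close>: one more index only adds a binary \<open>min\<close>,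
  which preserves continuity.\<close>

lemma continuous_on_min_fun:
  assumes "1 \<le> p" and "\<And>i. i \<in> {1..p} \<Longrightarrow> continuous_on S (g i)"
  shows "continuous_on S (min_fun p g)"
  using assms
proof (induction p rule: nat_induct_at_least)
  case base
  then show ?case by (simp add: min_fun_def[abs_def])
next
  case (Suc n)
  have "min_fun (Suc n) g = (\<lambda>x. min (g (Suc n) x) (min_fun n g x))"
    using Suc.hyps by (simp add: fun_eq_iff min_fun_def atLeastAtMostSuc_conv)
  then show ?case
    using Suc by (auto intro!: continuous_on_min)
qed

lemma min_fun_le: "i \<in> {1..p} \<Longrightarrow> min_fun p g x \<le> g i x"
  by (simp add: min_fun_def)

lemma obtain_active:
  assumes "1 \<le> p"
  obtains i where "i \<in> active_set p g x"
proof -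
  have "min_fun p g x \<in> (\<lambda>i. g i x) ` {1..p}"
    unfolding min_fun_def by (rule Min_in) (use assms in auto)
  then show thesis
    using that by (auto simp: active_set_def)
qed

text \<open>The level set of \<open>c\<close> in \<open>{0..t}\<close> is compact and, by the
  intermediate value theorem, nonempty, so it has a least element. A value at most \<open>c\<close>
  before that time would force a still earlier crossing, since \<open>H\<close> starts above
  \<open>c\<close>.\<close>

lemma first_time_at_level:
  fixes H :: "real \<Rightarrow> real"
  assumes "continuous_on {0..t} H" "0 \<le> t" "c < H 0" "H t \<le> c"
  obtains T where "0 < T" "T \<le> t" "H T = c" "\<And>s. 0 \<le> s \<Longrightarrow> s < T \<Longrightarrow> c < H s"
proof -
  define S where "S = {s \<in> {0..t}. H s = c}"
  have "S \<noteq> {}"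
    using IVT2'[of H t c 0] assms by (auto simp: S_def)
  moreover have "compact S"
  proof -
    have "closed S"
      unfolding S_def by (rule continuous_closed_preimage_constant[OF assms(1)]) simp
    moreover have "bounded S"
      by (rule bounded_subset[of "{0..t}"]) (auto simp: S_def)
    ultimately show ?thesis by (simp add: compact_eq_bounded_closed)
  qed
  ultimately obtain T where T: "T \<in> S" "\<And>s. s \<in> S \<Longrightarrow> T \<le> s"
    by (meson compact_attains_inf)
  have "c < H s" if "0 \<le> s" "s < T" for s
  proof (rule ccontr)
    assume "\<not> c < H s"
    moreover have "continuous_on {0..s} H"
      by (rule continuous_on_subset[OF assms(1)]) (use that T in \<open>auto simp: S_def\<close>)
    ultimately obtain r where "0 \<le> r" "r \<le> s" "H r = c"
      using IVT2'[of H s c 0] assms(3) \<open>0 \<le> s\<close> by auto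
    then show False
      using T(2)[of r] that T(1) by (auto simp: S_def)
  qed
  moreover have "0 < T"
    using T(1) assms(3) by (cases "T = 0") (auto simp: S_def)
  ultimately show thesis
    using that T(1) by (auto simp: S_def)
qed

text \<open>Puts the Frechet derivative into the gradient form in which the chain rule along a
  solution yields Lie derivatives.\<close>

lemma has_derivative_grad:
  assumes "h differentiable (at x)"
  shows "(h has_derivative (\<lambda>w. grad h x \<bullet> w)) (at x)"
proof -
  have "frechet_derivative h (at x) = (\<lambda>w. grad h x \<bullet> w)"
    using frechet_derivative_eq_grad[OF assms] by blast
  then show ?thesis
    using assms by (simp add: frechet_derivative_works)
qed

lemma ext_class_K_neg:
  assumes "ext_class_K a b \<alpha>" "- b < ereal c" "c < 0"
  shows "c \<in> einterval (- b) a" "\<alpha> c < 0"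
proof -
  have pos: "0 < a" "0 < b" and mono: "strict_mono_on (einterval (- b) a) \<alpha>" and "\<alpha> 0 = 0"
    using assms(1) by (auto simp: ext_class_K_def)
  have "ereal c < ereal 0"
    using assms(3) by simp
  also have "ereal 0 < a"
    using pos(1) by (simp add: zero_ereal_def)
  finally show c: "c \<in> einterval (- b) a"
    using assms(2) by (simp add: einterval_def)
  have "(0::real) \<in> einterval (- b) a"
    using pos by (simp add: einterval_def ereal_uminus_less_reorder flip: zero_ereal_def)
  with c mono \<open>\<alpha> 0 = 0\<close> assms(3) show "\<alpha> c < 0"
    by (metis strict_mono_onD)
qed

theorem theorem3:
  fixes D :: "(real^'n) set"
    and f :: "real^'n \<Rightarrow> real^'n"
    and G :: "real^'n \<Rightarrow> real^'m^'n"
    and p :: nat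
    and hs :: "nat \<Rightarrow> real^'n \<Rightarrow> real"
    and \<alpha> :: "real \<Rightarrow> real"
    and a b :: ereal
    and \<delta> :: real
    and u_star :: "real^'n \<Rightarrow> real^'m"
  assumes "open D"
    and "locally_lipschitz_on D f"
    and "continuous_on D G"
    and "1 \<le> p"
    and "\<And>i. i \<in> {1..p} \<Longrightarrow> continuously_differentiable_on D (hs i)"
    and "ext_class_K a b \<alpha>"
    and "\<And>x i. x \<in> D \<Longrightarrow> i \<in> active_set p hs x \<Longrightarrow> hs i x = 0 \<Longrightarrow>
           lie_deriv_row G (hs i) x \<noteq> 0 \<and>
           (\<exists>u. \<forall>k\<in>active_set p hs x.
              lie_deriv f (hs k) x + lie_deriv_row G (hs k) x \<bullet> u + \<alpha> (hs k x) \<ge> 0)"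
    and "0 < \<delta>"
    and "locally_lipschitz_on D u_star"
    and "\<And>x i. x \<in> D \<Longrightarrow> i \<in> delta_active_set \<delta> p hs x \<Longrightarrow> hs i x \<in> einterval (- b) a \<Longrightarrow>
           dual_lie_deriv f (hs i) x + dual_lie_deriv_row G (hs i) x \<bullet> u_star x + \<alpha> (hs i x) \<ge> 0"
  shows "forward_invariant D (\<lambda>x. f x + G x *v u_star x) {x\<in>D. min_fun p hs x \<ge> 0}"
proof -
  define H where "H = min_fun p hs"
  have diff: "hs i differentiable (at x)" if "i \<in> {1..p}" "x \<in> D" for i x
    using assms(5) that by (auto simp: continuously_differentiable_on_def)
  have contH: "continuous_on D H"
    unfolding H_def
    by (rule continuous_on_min_fun[OF assms(4)])
      (auto intro!: continuous_at_imp_continuous_on differentiable_imp_continuous_within diff)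
  have "H (\<phi> t) \<ge> 0"
    if sol: "is_solution D (\<lambda>x. f x + G x *v u_star x) J \<phi>" and init: "H (\<phi> 0) \<ge> 0"
      and t: "t \<in> J" "0 \<le> t" for J \<phi> t
  proof (rule ccontr)
    assume "\<not> H (\<phi> t) \<ge> 0"
    have sub: "{0..t} \<subseteq> J"
      using sol t by (auto simp: is_solution_def is_interval_1)
    have inD: "\<phi> s \<in> D"
      and der: "(\<phi> has_vector_derivative f (\<phi> s) + G (\<phi> s) *v u_star (\<phi> s)) (at s within {0..t})"
      if "s \<in> {0..t}" for s
      using sol sub that has_vector_derivative_within_subset unfolding is_solution_def by blast+
    have cont: "continuous_on {0..t} (\<lambda>s. H (\<phi> s))"
      by (rule continuous_on_compose2[OF contH])
        (auto intro: inD der has_vector_derivative_continuous simp: continuous_on_eq_continuous_within)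
    have "- b < 0"
      using assms(6) by (simp add: ext_class_K_def ereal_uminus_less_reorder)
    \<comment> \<open>The level \<open>c\<close> must lie above \<open>- b\<close>, so that
      \<open>\<alpha>\<close> is defined there, and above \<open>H (\<phi> t)\<close>, so that it is
      crossed. The maximum is taken in \<open>ereal\<close> because \<open>- b\<close> may be
      infinite.\<close>
    then have "max (- b) (ereal (H (\<phi> t))) < 0"
      using \<open>\<not> H (\<phi> t) \<ge> 0\<close> by simp
    then obtain c where "max (- b) (ereal (H (\<phi> t))) < ereal c" "ereal c < 0"
      using ereal_dense2 by blast
    then have c: "- b < ereal c" "H (\<phi> t) < c" "c < 0"
      by simp_all
    obtain T where T: "0 < T" "T \<le> t" "H (\<phi> T) = c" "\<And>s. 0 \<le> s \<Longrightarrow> s < T \<Longrightarrow> c < H (\<phi> s)"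
      by (rule first_time_at_level[OF cont, of c]) (use t c init in auto)
    let ?x = "\<phi> T"
    have "T \<in> {0..t}"
      using T by auto
    obtain i where "i \<in> active_set p hs ?x"
      using obtain_active[OF assms(4)] .
    then have i: "i \<in> {1..p}" "hs i ?x = c"
      using T(3) by (auto simp: active_set_def H_def)
    define l where "l = grad (hs i) ?x \<bullet> (f ?x + G ?x *v u_star ?x)"
    have "dual_lie_deriv f (hs i) ?x + dual_lie_deriv_row G (hs i) ?x \<bullet> u_star ?x + \<alpha> (hs i ?x) \<ge> 0"
      \<comment> \<open>An active index is \<delta>-active because \<delta> is positive, and the
        choice of \<open>c\<close> puts \<open>hs i ?x\<close> into the domain of \<alpha>.\<close>
      using assms(10)[OF inD, of T i] \<open>T \<in> {0..t}\<close> ext_class_K_neg(1)[OF assms(6) c(1,3)] i T(3) assms(8)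
      by (simp add: delta_active_set_def H_def)
    then have "l > 0"
      using ext_class_K_neg(2)[OF assms(6) c(1,3)] i
      by (simp add: l_def dual_lie_deriv_eq_inner dual_lie_deriv_row_inner inner_add_right)
    \<comment> \<open>With the index \<open>i\<close> fixed, the chain rule applies, although a
      minimum of differentiable functions may have kinks. The derivative is taken within
      \<open>{0..t}\<close>, which also covers \<open>T = t\<close>; only times to the left of
      \<open>T\<close> are used.\<close>
    have "((\<lambda>s. hs i (\<phi> s)) has_real_derivative l) (at T within {0..t})"
      using vector_derivative_diff_chain_within[OF der[OF \<open>T \<in> {0..t}\<close>]
          has_derivative_at_withinI[OF has_derivative_grad[OF diff[OF i(1) inD[OF \<open>T \<in> {0..t}\<close>]]]]]
      by (simp add: l_def o_def has_real_derivative_iff_has_vector_derivative)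
    from has_real_derivative_pos_inc_left[OF this \<open>l > 0\<close>]
    obtain d where d: "d > 0" "\<And>r. r > 0 \<Longrightarrow> T - r \<in> {0..t} \<Longrightarrow> r < d \<Longrightarrow> hs i (\<phi> (T - r)) < hs i ?x"
      by blast
    \<comment> \<open>Halving \<open>d\<close> makes \<open>r < d\<close> strict, and the bound by
      \<open>T\<close> keeps \<open>T - r\<close> nonnegative.\<close>
    define r where "r = min (d / 2) T"
    have r: "0 < r" "r < d" "r \<le> T"
      using d(1) T(1) by (auto simp: r_def)
    have "H (\<phi> (T - r)) \<le> hs i (\<phi> (T - r))"
      unfolding H_def by (rule min_fun_le[OF i(1)])
    also have "\<dots> < c"
      using d(2)[of r] r T(2) i(2) by simp
    finally show False
      using T(4)[of "T - r"] r by simp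
  qed
  then show ?thesis
    by (auto simp: forward_invariant_def H_def is_solution_def)
qed

end
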